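(* Let $A\in\mathbb{Q}_s^{m\times n}$ be nonzero, let $M=A^\sigma$, and assume $$0<\alpha<\frac{2}{\|M\|_2^2}.$$ Let $\widehat X_k\in\mathbb{Q}_s^{n\times m}$ be generated by $$\widehat X_0=\alpha A^H,\qquad \widehat X_{k+1}=\widehat X_k(2I_m-A\widehat X_k),$$ and define $X_k=(\widehat X_k)^\sigma$. Then $$X_0=\alpha M^T,\qquad X_{k+1}=X_k(2I_{2m}-MX_k)\quad\text{for all }k\ge0 .$$ Consequently, $\widehat X_k\to A^\dagger$. Furthermore, with $\widehat E_k=\widehat X_k-A^\dagger$, $$\widehat E_{k+1}=-\widehat E_kA\widehat E_k,$$ and the bound $$\|\widehat E_{k+1}\|_F\leq\sqrt2\,\|A\|_{\sigma,2}\,\|\widehat E_k\|_F^2$$ holds.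
   Context: $\mathbb{Q}_s$ is the real algebra of split quaternions $q=q_1+q_2\mathbf{i}+q_3\mathbf{j}+q_4\mathbf{k}$ ($q_\ell\in\mathbb{R}$) with $\mathbf{i}^2=-1$, $\mathbf{j}^2=\mathbf{k}^2=1$, $\mathbf{i}\mathbf{j}=\mathbf{k}=-\mathbf{j}\mathbf{i}$, $\mathbf{j}\mathbf{k}=-\mathbf{i}=-\mathbf{k}\mathbf{j}$, $\mathbf{k}\mathbf{i}=\mathbf{j}=-\mathbf{i}\mathbf{k}$. A matrix $A\in\mathbb{Q}_s^{m\times n}$ is written $A=A_1+A_2\mathbf{i}+A_3\mathbf{j}+A_4\mathbf{k}$ with $A_\ell\in\mathbb{R}^{m\times n}$. Its real representation is $$A^\sigma=\begin{bmatrix} A_1+A_3 & -A_2+A_4 \\ A_2+A_4 & A_1-A_3 \end{bmatrix}\in\mathbb{R}^{2m\times 2n};$$ the map $\sigma: A\mapsto A^\sigma$ is a bijection $\mathbb{Q}_s^{m\times n}\to\mathbb{R}^{2m\times 2n}$ with inverse $\sigma^{-1}$ (for all sizes). The $i$-conjugate transpose is $A^H:=A_1^T-A_2^T\mathbf{i}+A_3^T\mathbf{j}+A_4^T\mathbf{k}$. For a real matrix $M$, $M^\dagger$ is the usual real Moore--Penrose inverse; for $A\in\mathbb{Q}_s^{m\times n}$, $A^\dagger:=\sigma^{-1}((A^\sigma)^\dagger)\in\mathbb{Q}_s^{n\times m}$. Norms: $\|A\|_F^2:=\sum_{\ell=1}^4\|A_\ell\|_F^2$ for split-quaternion $A$ (convergence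 is in this norm), $\|\cdot\|_2$ is the spectral norm of real matrices, and $\|A\|_{\sigma,2}:=\|A^\sigma\|_2$. *)

theory Defs
  imports "HOL-Analysis.Analysis"
begin

codatatype split_quat = SQuat (sq1: real) (sq2: real) (sq3: real) (sq4: real)

lemma split_quat_eqI:
  "sq1 p = sq1 q \<Longrightarrow> sq2 p = sq2 q \<Longrightarrow> sq3 p = sq3 q \<Longrightarrow> sq4 p = sq4 q \<Longrightarrow> p = q"
  by (rule split_quat.expand) simp

lemma split_quat_eq_iff:
  "p = q \<longleftrightarrow> sq1 p = sq1 q \<and> sq2 p = sq2 q \<and> sq3 p = sq3 q \<and> sq4 p = sq4 q"
  by (auto intro: split_quat_eqI)

instantiation split_quat :: ring_1
begin

primcorec zero_split_quat where
  "sq1 0 = 0" | "sq2 0 = 0" | "sq3 0 = 0" | "sq4 0 = 0"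

primcorec one_split_quat where
  "sq1 1 = 1" | "sq2 1 = 0" | "sq3 1 = 0" | "sq4 1 = 0"

primcorec plus_split_quat where
  "sq1 (p + q) = sq1 p + sq1 q"
| "sq2 (p + q) = sq2 p + sq2 q"
| "sq3 (p + q) = sq3 p + sq3 q"
| "sq4 (p + q) = sq4 p + sq4 q"

primcorec uminus_split_quat where
  "sq1 (- p) = - sq1 p"
| "sq2 (- p) = - sq2 p"
| "sq3 (- p) = - sq3 p"
| "sq4 (- p) = - sq4 p"

primcorec minus_split_quat where
  "sq1 (p - q) = sq1 p - sq1 q"
| "sq2 (p - q) = sq2 p - sq2 q"
| "sq3 (p - q) = sq3 p - sq3 q"
| "sq4 (p - q) = sq4 p - sq4 q"

primcorec times_split_quat where
  "sq1 (p * q) = sq1 p * sq1 q - sq2 p * sq2 q + sq3 p * sq3 q + sq4 p * sq4 q"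
| "sq2 (p * q) = sq1 p * sq2 q + sq2 p * sq1 q - sq3 p * sq4 q + sq4 p * sq3 q"
| "sq3 (p * q) = sq1 p * sq3 q - sq2 p * sq4 q + sq3 p * sq1 q + sq4 p * sq2 q"
| "sq4 (p * q) = sq1 p * sq4 q + sq2 p * sq3 q - sq3 p * sq2 q + sq4 p * sq1 q"

instance
  by standard (auto simp: split_quat_eq_iff algebra_simps)

end

instantiation split_quat :: real_algebra_1
begin

primcorec scaleR_split_quat where
  "sq1 (r *\<^sub>R q) = r * sq1 q"
| "sq2 (r *\<^sub>R q) = r * sq2 q"
| "sq3 (r *\<^sub>R q) = r * sq3 q"
| "sq4 (r *\<^sub>R q) = r * sq4 q"

instance
  by standard (auto simp: split_quat_eq_iff algebra_simps)

end

instantiation split_quat :: real_normed_vector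
begin

definition norm_split_quat_def:
  "norm (q :: split_quat) = sqrt ((sq1 q)\<^sup>2 + (sq2 q)\<^sup>2 + (sq3 q)\<^sup>2 + (sq4 q)\<^sup>2)"

definition sgn_split_quat_def:
  "sgn (q :: split_quat) = q /\<^sub>R norm q"

definition dist_split_quat_def:
  "dist (p :: split_quat) q = norm (p - q)"

definition uniformity_split_quat_def:
  "(uniformity :: (split_quat \<times> split_quat) filter) =
     (INF e\<in>{0 <..}. principal {(p, q). dist p q < e})"

definition open_split_quat_def:
  "open (U :: split_quat set) \<longleftrightarrow>
     (\<forall>p\<in>U. eventually (\<lambda>(p', q). p' = p \<longrightarrow> q \<in> U) uniformity)"

instance
proof
  have tuple: "norm q = norm (sq1 q, sq2 q, sq3 q, sq4 q)" for q :: split_quat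
    by (simp add: norm_split_quat_def norm_Pair real_norm_def algebra_simps)
  fix p q :: split_quat and r :: real
  show "norm q = 0 \<longleftrightarrow> q = 0"
    by (simp add: tuple split_quat_eq_iff zero_prod_def)
  show "norm (p + q) \<le> norm p + norm q"
    using norm_triangle_ineq[of "(sq1 p, sq2 p, sq3 p, sq4 p)" "(sq1 q, sq2 q, sq3 q, sq4 q)"]
    by (simp add: tuple)
  show "norm (r *\<^sub>R q) = \<bar>r\<bar> * norm q"
    using norm_scaleR[of r "(sq1 q, sq2 q, sq3 q, sq4 q)"]
    by (simp add: tuple)
qed (simp_all add: sgn_split_quat_def dist_split_quat_def uniformity_split_quat_def
    open_split_quat_def)

end

definition sq_i :: split_quat where "sq_i = SQuat 0 1 0 0"
definition sq_j :: split_quat where "sq_j = SQuat 0 0 1 0"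
definition sq_k :: split_quat where "sq_k = SQuat 0 0 0 1"

lemma split_quat_mult_table:
  "sq_i * sq_i = -1" "sq_j * sq_j = 1" "sq_k * sq_k = 1"
  "sq_i * sq_j = sq_k" "sq_j * sq_i = - sq_k"
  "sq_j * sq_k = - sq_i" "sq_k * sq_j = sq_i"
  "sq_k * sq_i = sq_j" "sq_i * sq_k = - sq_j"
  by (simp_all add: split_quat_eq_iff sq_i_def sq_j_def sq_k_def)

lemma split_quat_expand:
  "q = sq1 q *\<^sub>R 1 + sq2 q *\<^sub>R sq_i + sq3 q *\<^sub>R sq_j + sq4 q *\<^sub>R sq_k"
  by (simp add: split_quat_eq_iff sq_i_def sq_j_def sq_k_def)

definition qmat :: "real^'n^'m \<Rightarrow> real^'n^'m \<Rightarrow> real^'n^'m \<Rightarrow> real^'n^'m \<Rightarrow> split_quat^'n^'m" where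
  "qmat B1 B2 B3 B4 = (\<chi> i j. SQuat (B1$i$j) (B2$i$j) (B3$i$j) (B4$i$j))"

definition qpart1 :: "split_quat^'n^'m \<Rightarrow> real^'n^'m" where
  "qpart1 A = (\<chi> i j. sq1 (A$i$j))"

definition qpart2 :: "split_quat^'n^'m \<Rightarrow> real^'n^'m" where
  "qpart2 A = (\<chi> i j. sq2 (A$i$j))"

definition qpart3 :: "split_quat^'n^'m \<Rightarrow> real^'n^'m" where
  "qpart3 A = (\<chi> i j. sq3 (A$i$j))"

definition qpart4 :: "split_quat^'n^'m \<Rightarrow> real^'n^'m" where
  "qpart4 A = (\<chi> i j. sq4 (A$i$j))"

lemmas qpart_defs = qpart1_def qpart2_def qpart3_def qpart4_def

lemma qmat_qpart: "qmat (qpart1 A) (qpart2 A) (qpart3 A) (qpart4 A) = A"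
  by (simp add: qmat_def qpart_defs vec_eq_iff)

text \<open>A \<open>2m \<times> 2n\<close> matrix is indexed by the sum types \<open>'m + 'm\<close> and \<open>'n + 'n\<close>,
  with \<open>Inl\<close> for the first and \<open>Inr\<close> for the second block of indices.\<close>

definition block_matrix ::
  "real^'n^'m \<Rightarrow> real^'n^'m \<Rightarrow> real^'n^'m \<Rightarrow> real^'n^'m \<Rightarrow> real^('n + 'n)^('m + 'm)" where
  "block_matrix P Q R S = (\<chi> r c. case (r, c) of
      (Inl i, Inl j) \<Rightarrow> P$i$j
    | (Inl i, Inr j) \<Rightarrow> Q$i$j
    | (Inr i, Inl j) \<Rightarrow> R$i$j
    | (Inr i, Inr j) \<Rightarrow> S$i$j)"

definition real_rep :: "split_quat^'n^'m \<Rightarrow> real^('n + 'n)^('m + 'm)" where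
  "real_rep A = block_matrix
     (qpart1 A + qpart3 A)   (- qpart2 A + qpart4 A)
     (qpart2 A + qpart4 A)   (qpart1 A - qpart3 A)"

lemma bij_real_rep: "bij (real_rep :: split_quat^'n^'m \<Rightarrow> _)"
proof (rule bijI)
  show "inj (real_rep :: split_quat^'n^'m \<Rightarrow> _)"
  proof (rule injI)
    fix A B :: "split_quat^'n^'m"
    assume eq: "real_rep A = real_rep B"
    have *: "real_rep A $ r $ c = real_rep B $ r $ c" for r c
      by (simp add: eq)
    show "A = B"
      unfolding vec_eq_iff
    proof (intro allI)
      fix i j
      show "A$i$j = B$i$j"
        using *[of "Inl i" "Inl j"] *[of "Inl i" "Inr j"] *[of "Inr i" "Inl j"] *[of "Inr i" "Inr j"]
        by (simp add: real_rep_def block_matrix_def qpart_defs split_quat_eq_iff)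
    qed
  qed
next
  show "surj (real_rep :: split_quat^'n^'m \<Rightarrow> _)"
  proof (rule surjI)
    fix M :: "real^('n + 'n)^('m + 'm)"
    show "real_rep (\<chi> i j. SQuat
        ((M$(Inl i)$(Inl j) + M$(Inr i)$(Inr j)) / 2)
        ((M$(Inr i)$(Inl j) - M$(Inl i)$(Inr j)) / 2)
        ((M$(Inl i)$(Inl j) - M$(Inr i)$(Inr j)) / 2)
        ((M$(Inr i)$(Inl j) + M$(Inl i)$(Inr j)) / 2)) = M"
      by (auto simp: real_rep_def block_matrix_def qpart_defs vec_eq_iff field_simps
          split: sum.split)
  qed
qed

definition qconj_transpose :: "split_quat^'n^'m \<Rightarrow> split_quat^'m^'n" where
  "qconj_transpose A =
     qmat (transpose (qpart1 A)) (- transpose (qpart2 A)) (transpose (qpart3 A)) (transpose (qpart4 A))"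

definition is_moore_penrose :: "real^'n^'m \<Rightarrow> real^'m^'n \<Rightarrow> bool" where
  "is_moore_penrose M X \<longleftrightarrow>
     M ** X ** M = M \<and> X ** M ** X = X \<and>
     transpose (M ** X) = M ** X \<and> transpose (X ** M) = X ** M"

lemma is_moore_penrose_unique:
  assumes "is_moore_penrose M X" "is_moore_penrose M Y"
  shows "X = Y"
proof -
  have "X = X ** M ** X" "Y = Y ** M ** Y" and
    M: "M ** X ** M = M" "M ** Y ** M = M" and
    T: "transpose (M ** X) = M ** X" "transpose (X ** M) = X ** M"
       "transpose (M ** Y) = M ** Y" "transpose (Y ** M) = Y ** M"
    using assms by (simp_all add: is_moore_penrose_def)
  have "M ** X = transpose (M ** Y ** M ** X)" by (simp add: M T)
  also have "\<dots> = transpose (M ** X) ** transpose (M ** Y)"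
    by (simp add: matrix_transpose_mul[symmetric] matrix_mul_assoc)
  also have "\<dots> = M ** Y" by (simp add: T matrix_mul_assoc M)
  finally have MX: "M ** X = M ** Y" .
  have "X ** M = transpose (X ** (M ** Y ** M))" by (simp add: M T)
  also have "\<dots> = transpose (Y ** M) ** transpose (X ** M)"
    by (simp add: matrix_transpose_mul[symmetric] matrix_mul_assoc)
  also have "\<dots> = Y ** (M ** X ** M)" by (simp only: T matrix_mul_assoc)
  also have "\<dots> = Y ** M" by (simp only: M)
  finally have XM: "X ** M = Y ** M" .
  have "X = X ** (M ** X)" using \<open>X = X ** M ** X\<close> by (simp add: matrix_mul_assoc)
  also have "\<dots> = Y ** M ** Y" by (simp add: MX matrix_mul_assoc XM)
  finally show ?thesis using \<open>Y = Y ** M ** Y\<close> by simp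
qed

definition real_pinv :: "real^'n^'m \<Rightarrow> real^'m^'n" where
  "real_pinv M = (THE X. is_moore_penrose M X)"

definition qpinv :: "split_quat^'n^'m \<Rightarrow> split_quat^'m^'n" where
  "qpinv A = inv real_rep (real_pinv (real_rep A))"

definition frobenius_norm :: "real^'n^'m \<Rightarrow> real" where
  "frobenius_norm B = sqrt (\<Sum>i\<in>UNIV. \<Sum>j\<in>UNIV. (B$i$j)\<^sup>2)"

definition qfrobenius_norm :: "split_quat^'n^'m \<Rightarrow> real" where
  "qfrobenius_norm A = sqrt ((frobenius_norm (qpart1 A))\<^sup>2 + (frobenius_norm (qpart2 A))\<^sup>2 +
     (frobenius_norm (qpart3 A))\<^sup>2 + (frobenius_norm (qpart4 A))\<^sup>2)"

text \<open>Hence the library topology on \<^typ>\<open>split_quat^'n^'m\<close> is that of the Frobenius norm.\<close>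

lemma norm_eq_qfrobenius_norm: "norm A = qfrobenius_norm A" for A :: "split_quat^'n^'m"
  by (simp add: norm_vec_def L2_set_def qfrobenius_norm_def frobenius_norm_def qpart_defs
      norm_split_quat_def sum_nonneg sum.distrib)

definition spectral_norm :: "real^'n^'m \<Rightarrow> real" where
  "spectral_norm B = onorm ((*v) B)"

definition sigma2_norm :: "split_quat^'n^'m \<Rightarrow> real" where
  "sigma2_norm A = spectral_norm (real_rep A)"

end

theory Submission imports Defs begin

text \<open>The real representation is an injective homomorphism that turns \<open>A\<^sup>H\<close> into \<open>M\<^sup>T\<close> and
  scales the Frobenius norm by \<open>\<surd>2\<close>, so everything reduces to the real iteration. Write
  \<open>P = M\<^sup>\<dagger>\<close>. The invariants \<open>X\<^sub>k M P = X\<^sub>k = P M X\<^sub>k\<close> give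
  \<open>X\<^sub>k\<^sub>+\<^sub>1 - P = -(X\<^sub>k - P) M (X\<^sub>k - P)\<close>. Hence \<open>G\<^sub>k = P M - X\<^sub>k M\<close> satisfies
  \<open>G\<^sub>k\<^sub>+\<^sub>1 = G\<^sub>k\<^sup>2\<close>; since \<open>\<parallel>G\<^sub>0\<parallel>\<^sub>2 < 1\<close>, \<open>P - X\<^sub>k = G\<^sub>k P\<close> tends to \<open>0\<close>.\<close>

section \<open>Matrices over rings\<close>

lemma matrix_diff_ldistrib: "A ** (B - C) = A ** B - A ** C"
  for A :: "'a::ring_1^'n^'m"
  by (simp add: matrix_matrix_mult_def vec_eq_iff right_diff_distrib sum_subtractf)

lemma matrix_diff_rdistrib: "(B - C) ** A = B ** A - C ** A"
  for A :: "'a::ring_1^'n^'m"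
  by (simp add: matrix_matrix_mult_def vec_eq_iff left_diff_distrib sum_subtractf)

lemma inner_matrix_vector: "(A *v x) \<bullet> y = x \<bullet> (transpose A *v y)"
  for A :: "real^'n^'m"
  by (metis dot_lmul_matrix transpose_matrix_vector transpose_transpose)

section \<open>Norms of real matrices\<close>

lemma norm_matrix_power2: "(norm B)\<^sup>2 = (\<Sum>i\<in>UNIV. \<Sum>j\<in>UNIV. (B$i$j)\<^sup>2)"
  for B :: "real^'n^'m"
  by (simp add: norm_vec_def L2_set_def sum_nonneg)

lemma norm_matrix_columns: "(norm B)\<^sup>2 = (\<Sum>j\<in>UNIV. (norm (column j B))\<^sup>2)"
  for B :: "real^'n^'m"
  unfolding norm_matrix_power2
  by (subst sum.swap) (simp add: norm_vec_def L2_set_def column_def sum_nonneg)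

lemma spectral_norm_nonneg: "0 \<le> spectral_norm B"
  unfolding spectral_norm_def by (rule onorm_pos_le[OF matrix_vector_mul_bounded_linear])

lemma norm_matrix_vector_le: "norm (B *v x) \<le> spectral_norm B * norm x"
  unfolding spectral_norm_def by (rule onorm[OF matrix_vector_mul_bounded_linear])

text \<open>With y = B^T x, |y|^2 = <B y, x>, which Cauchy-Schwarz bounds by the spectral norm of B
  times |y| |x|; a factor |y| then cancels.\<close>

lemma norm_transpose_vector_le: "norm (transpose B *v x) \<le> spectral_norm B * norm x"
  for B :: "real^'n^'m"
proof -
  let ?y = "transpose B *v x"
  have "(norm ?y)\<^sup>2 = (B *v ?y) \<bullet> x"
    by (simp add: inner_matrix_vector power2_norm_eq_inner)
  also have "\<dots> \<le> norm (B *v ?y) * norm x"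
    by (rule norm_cauchy_schwarz)
  also have "\<dots> \<le> spectral_norm B * norm ?y * norm x"
    by (intro mult_right_mono norm_matrix_vector_le) simp
  finally have "norm ?y * norm ?y \<le> (spectral_norm B * norm x) * norm ?y"
    by (simp add: power2_eq_square mult_ac)
  then show ?thesis
    by (cases "norm ?y = 0") (auto simp: spectral_norm_nonneg mult_le_cancel_right)
qed

text \<open>\<open>norm\<close> of a matrix is its Frobenius norm, so its square is a sum over
  columns, and the spectral bound applies to each column of C separately.\<close>

lemma norm_matrix_mult_spectral_le: "norm (B ** C) \<le> spectral_norm B * norm C"
  for B :: "real^'n^'m" and C :: "real^'k^'n"
proof -
  have "column j (B ** C) = B *v column j C" for j
    by (simp add: column_def matrix_matrix_mult_def matrix_vector_mult_def vec_eq_iff)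
  then have "(norm (B ** C))\<^sup>2 = (\<Sum>j\<in>UNIV. (norm (B *v column j C))\<^sup>2)"
    by (simp add: norm_matrix_columns)
  also have "\<dots> \<le> (\<Sum>j\<in>UNIV. (spectral_norm B * norm (column j C))\<^sup>2)"
    by (intro sum_mono power_mono norm_matrix_vector_le) simp
  also have "\<dots> = (spectral_norm B * norm C)\<^sup>2"
    by (simp add: power_mult_distrib sum_distrib_left norm_matrix_columns[of C])
  finally show ?thesis
    by (rule power2_le_imp_le) (simp add: spectral_norm_nonneg)
qed

lemma norm_matrix_vector_le_norm: "norm (B *v x) \<le> norm B * norm x"
  for B :: "real^'n^'m"
proof -
  have "(norm (B *v x))\<^sup>2 = (\<Sum>i\<in>UNIV. (B$i \<bullet> x)\<^sup>2)"
    by (simp add: norm_vec_def L2_set_def sum_nonneg matrix_vector_mult_def inner_vec_def)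
  also have "\<dots> \<le> (\<Sum>i\<in>UNIV. (norm (B$i) * norm x)\<^sup>2)"
    by (intro sum_mono) (metis Cauchy_Schwarz_ineq2 power2_abs power_mono abs_ge_zero)
  also have "\<dots> = (norm B * norm x)\<^sup>2"
    by (simp add: power_mult_distrib sum_distrib_right norm_vec_def[of B] L2_set_def sum_nonneg)
  finally show ?thesis
    by (rule power2_le_imp_le) simp
qed

lemma spectral_norm_le_norm: "spectral_norm B \<le> norm B"
  unfolding spectral_norm_def by (rule onorm_le[OF norm_matrix_vector_le_norm])

lemma norm_matrix_mult_le: "norm (B ** C) \<le> norm B * norm C"
  for B :: "real^'n^'m" and C :: "real^'k^'n"
  using norm_matrix_mult_spectral_le[of B C] spectral_norm_le_norm[of B]
  by (meson mult_right_mono norm_ge_zero order_trans)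

lemma spectral_norm_mult_le: "spectral_norm (B ** C) \<le> spectral_norm B * spectral_norm C"
  for B :: "real^'n^'m" and C :: "real^'k^'n"
proof -
  have "(*v) (B ** C) = (*v) B \<circ> (*v) C"
    by (simp add: fun_eq_iff matrix_vector_mul_assoc)
  then show ?thesis
    unfolding spectral_norm_def
    by (simp add: onorm_compose[OF matrix_vector_mul_bounded_linear matrix_vector_mul_bounded_linear])
qed

section \<open>Existence of the Moore--Penrose inverse\<close>

text \<open>The matrix of a linear right inverse of B on the range of B serves as G.\<close>

lemma generalized_inverse_exists:
  fixes B :: "real^'n^'m"
  obtains G where "B ** G ** B = B"
proof -
  obtain g where g: "linear g" "\<And>x. B *v g (B *v x) = B *v x"
    using linear_exists_right_inverse_on[of "(*v) B" UNIV] by auto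
  have "B ** matrix g ** B = B"
    unfolding matrix_eq matrix_vector_mul_assoc[symmetric] matrix_vector_mul(2)[OF g(1)]
    by (simp add: g(2))
  then show thesis by (rule that)
qed

text \<open>For every x, |A U x|^2 = <U x, A^T A U x> = 0.\<close>

lemma transpose_mult_eq_0_cancel:
  fixes A :: "real^'n^'m" and U :: "real^'k^'n"
  assumes "transpose A ** (A ** U) = 0"
  shows "A ** U = 0"
proof -
  have "(A ** U) *v x = 0" for x
  proof -
    have "((A ** U) *v x) \<bullet> ((A ** U) *v x) = (U *v x) \<bullet> ((transpose A ** (A ** U)) *v x)"
      by (simp only: matrix_vector_mul_assoc[symmetric] inner_matrix_vector)
    then show ?thesis by (simp add: assms)
  qed
  then show ?thesis by (simp add: matrix_eq)
qed

lemma transpose_mult_left_cancel: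
  fixes A :: "real^'n^'m" and U V :: "real^'k^'n"
  assumes "transpose A ** (A ** U) = transpose A ** (A ** V)"
  shows "A ** U = A ** V"
  using transpose_mult_eq_0_cancel[of A "U - V"] assms by (simp add: matrix_diff_ldistrib)

lemma transpose_mult_right_cancel:
  fixes A :: "real^'n^'m" and U V :: "real^'m^'k"
  assumes "U ** A ** transpose A = V ** A ** transpose A"
  shows "U ** A = V ** A"
proof -
  have "transpose (U ** A ** transpose A) = transpose (V ** A ** transpose A)"
    by (simp add: assms)
  then have "transpose A ** transpose U = transpose A ** transpose V"
    by - (rule transpose_mult_left_cancel, simp add: matrix_transpose_mul)
  then show ?thesis
    by (metis matrix_transpose_mul transpose_transpose)
qed

text \<open>Zlobec's formula: \<open>A\<^sup>T G A\<^sup>T\<close> is the Moore--Penrose inverse of \<open>A\<close> for any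
  generalized inverse \<open>G\<close> of \<open>A\<^sup>T A A\<^sup>T\<close>.\<close>

lemma moore_penrose_exists:
  fixes A :: "real^'n^'m"
  shows "\<exists>X. is_moore_penrose A X"
proof -
  let ?T = "transpose A"
  obtain G where G: "(?T ** A ** ?T) ** G ** (?T ** A ** ?T) = ?T ** A ** ?T"
    by (rule generalized_inverse_exists)
  define X where "X = ?T ** G ** ?T"
  \<comment> \<open>Cancelling first T and then A on the left of \<open>G\<close> leaves T G T A T =
    T, that is, X A T = T. The same cancellations from the right give T A X = T below.\<close>
  have "A ** (?T ** G ** ?T ** A ** ?T) = A ** ?T"
    by (rule transpose_mult_left_cancel) (use G in \<open>simp add: matrix_mul_assoc\<close>)
  then have "?T ** (G ** ?T ** A ** ?T) = ?T ** mat 1"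
    by - (rule transpose_mult_left_cancel[of ?T], simp add: matrix_mul_assoc)
  then have XA: "X ** A ** ?T = ?T"
    by (simp add: X_def matrix_mul_assoc)
  have "?T ** A ** ?T ** G ** ?T ** A = ?T ** A"
    by (rule transpose_mult_right_cancel) (use G in \<open>simp add: matrix_mul_assoc\<close>)
  then have "(?T ** A ** ?T ** G) ** ?T = mat 1 ** ?T"
    by - (rule transpose_mult_right_cancel[of _ ?T], simp add: matrix_mul_assoc)
  then have AX: "?T ** A ** X = ?T"
    by (simp add: X_def matrix_mul_assoc)
  have TX: "A ** ?T ** transpose X = A" "transpose X ** ?T ** A = A"
    using arg_cong[OF XA, of transpose] arg_cong[OF AX, of transpose]
    by (simp_all add: matrix_transpose_mul matrix_mul_assoc)
  \<comment> \<open>Inserting A = A T X^T and then X A T = T turns X A into T X^T, its own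
    transpose. The mirror argument handles A X.\<close>
  have "X ** A = X ** A ** ?T ** transpose X"
    using TX(1) by (metis matrix_mul_assoc)
  then have "X ** A = transpose (X ** A)"
    by (simp add: XA matrix_transpose_mul)
  moreover have "A ** X = transpose X ** (?T ** A ** X)"
    using TX(2) by (metis matrix_mul_assoc)
  then have "A ** X = transpose (A ** X)"
    by (simp add: AX matrix_transpose_mul)
  moreover have "X ** A ** X = X"
    by (metis XA X_def matrix_mul_assoc)
  moreover have "A ** X ** A = A"
    by (metis \<open>A ** X = transpose (A ** X)\<close> TX(2) matrix_transpose_mul)
  ultimately show ?thesis
    unfolding is_moore_penrose_def by metis
qed

lemma is_moore_penrose_real_pinv: "is_moore_penrose M (real_pinv M)"
  unfolding real_pinv_def
  by (rule theI') (use moore_penrose_exists is_moore_penrose_unique in blast)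

section \<open>The Newton--Schulz iteration for real matrices\<close>

text \<open>M P and P M are the orthogonal projections onto the column and row spaces of M.
  Transposing M P M = M shows that M^T absorbs both, and this passes from X to X M X and to linear
  combinations.\<close>

lemma newton_schulz_residual:
  fixes M :: "real^'n^'m" and P :: "real^'m^'n" and X :: "nat \<Rightarrow> real^'m^'n"
  assumes P: "is_moore_penrose M P"
    and X0: "X 0 = \<alpha> *\<^sub>R transpose M"
    and XS: "\<And>k. X (Suc k) = X k ** (2 *\<^sub>R mat 1 - M ** X k)"
  shows "X k ** M ** P = X k" and "P ** M ** X k = X k"
proof -
  have T: "transpose M ** M ** P = transpose M" "P ** M ** transpose M = transpose M"
    using P unfolding is_moore_penrose_def
    by (metis matrix_mul_assoc matrix_transpose_mul)+
  have "X k ** M ** P = X k \<and> P ** M ** X k = X k"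
  proof (induction k)
    case 0
    then show ?case
      by (simp add: X0 T matrix_scalar_ac flip: scalar_matrix_assoc)
  next
    case (Suc k)
    have S: "X (Suc k) = 2 *\<^sub>R X k - X k ** M ** X k"
      by (simp add: XS matrix_diff_ldistrib matrix_scalar_ac matrix_mul_assoc)
    have "X k ** M ** X k ** M ** P = X k ** M ** X k" "P ** M ** (X k ** M ** X k) = X k ** M ** X k"
      using Suc by (metis matrix_mul_assoc)+
    then show ?case
      using Suc by (simp add: S matrix_diff_ldistrib matrix_diff_rdistrib matrix_scalar_ac flip: scalar_matrix_assoc)
  qed
  then show "X k ** M ** P = X k" "P ** M ** X k = X k" by auto
qed

text \<open>When the product is expanded, the cross terms X M P and P M X both collapse to X, and P
  M P to P.\<close>

lemma newton_schulz_error: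
  fixes M :: "real^'n^'m" and P :: "real^'m^'n" and X :: "nat \<Rightarrow> real^'m^'n"
  assumes P: "is_moore_penrose M P"
    and X0: "X 0 = \<alpha> *\<^sub>R transpose M"
    and XS: "\<And>k. X (Suc k) = X k ** (2 *\<^sub>R mat 1 - M ** X k)"
  shows "X (Suc k) - P = - ((X k - P) ** M ** (X k - P))"
proof -
  note R = newton_schulz_residual[OF P X0 XS]
  have "P ** M ** P = P" using P by (simp add: is_moore_penrose_def)
  then have "(X k - P) ** M ** (X k - P) = X k ** M ** X k - X k - X k + P"
    by (simp add: R matrix_diff_ldistrib matrix_diff_rdistrib)
  moreover have "X (Suc k) = X k + X k - X k ** M ** X k"
    by (simp add: XS matrix_diff_ldistrib matrix_scalar_ac matrix_mul_assoc flip: scaleR_2)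
  ultimately show ?thesis by simp
qed

text \<open>On the row space of \<open>M\<close>, which is the range of \<open>P M\<close>, the inequality
  \<open>|z| \<le> \<parallel>P\<parallel> |M z|\<close> bounds \<open>M\<close> from below; expanding \<open>|z - \<alpha> M\<^sup>T M z|\<^sup>2\<close> then gives
  a contraction without any use of singular values.\<close>

lemma initial_residual_contraction:
  fixes M :: "real^'n^'m" and P :: "real^'m^'n"
  assumes P: "is_moore_penrose M P"
    and \<alpha>: "0 < \<alpha>" "\<alpha> < 2 / (spectral_norm M)\<^sup>2"
  shows "spectral_norm (P ** M - \<alpha> *\<^sub>R (transpose M ** M)) < 1"
proof -
  define s where "s = spectral_norm M"
  \<comment> \<open>The added 1 makes K positive whatever P is, so division by K^2 is safe.\<close>
  define K where "K = spectral_norm P + 1"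
  \<comment> \<open>The squared norm drops by at least \<alpha> (2 - \<alpha> s^2) |w|^2, and |z|
    \<le> K |w| turns this into the fraction c of |z|^2.\<close>
  define c where "c = \<alpha> * (2 - \<alpha> * s\<^sup>2) / K\<^sup>2"
  define r where "r = sqrt (max 0 (1 - c))"
  \<comment> \<open>For s = 0 the convention 2 / 0 = 0 would give 0 < \<alpha> < 0.\<close>
  have "s \<noteq> 0" using \<alpha> by (auto simp: s_def)
  then have "\<alpha> * s\<^sup>2 < 2" using \<alpha>(2) by (simp add: s_def pos_less_divide_eq)
  have "K > 0" unfolding K_def using spectral_norm_nonneg[of P] by linarith
  then have "c > 0" unfolding c_def using \<alpha>(1) \<open>\<alpha> * s\<^sup>2 < 2\<close> by simp
  then have "r < 1" by (simp add: r_def)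
  have "norm ((P ** M - \<alpha> *\<^sub>R (transpose M ** M)) *v x) \<le> r * norm x" for x
  proof -
    define z where "z = (P ** M) *v x"
    define w where "w = M *v z"
    have Mz: "w = M *v x"
      using P by (simp add: w_def z_def matrix_vector_mul_assoc matrix_mul_assoc is_moore_penrose_def)
    have zP: "z = P *v w"
      by (simp add: Mz z_def matrix_vector_mul_assoc)
    have "norm z \<le> spectral_norm P * norm w"
      unfolding zP by (rule norm_matrix_vector_le)
    also have "\<dots> \<le> K * norm w" by (intro mult_right_mono) (auto simp: K_def)
    finally have "(norm z)\<^sup>2 \<le> K\<^sup>2 * (norm w)\<^sup>2"
      by (metis norm_ge_zero power_mono power_mult_distrib)
    then have "(norm z)\<^sup>2 / K\<^sup>2 \<le> (norm w)\<^sup>2"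
      using \<open>K > 0\<close> by (simp add: pos_divide_le_eq mult_ac)
    then have zw: "c * (norm z)\<^sup>2 \<le> \<alpha> * (2 - \<alpha> * s\<^sup>2) * (norm w)\<^sup>2"
      using mult_left_mono[of _ _ "\<alpha> * (2 - \<alpha> * s\<^sup>2)"] \<alpha>(1) \<open>\<alpha> * s\<^sup>2 < 2\<close>
      unfolding c_def by fastforce
    have sw: "(norm (transpose M *v w))\<^sup>2 \<le> s\<^sup>2 * (norm w)\<^sup>2"
      by (metis norm_transpose_vector_le s_def norm_ge_zero power_mono power_mult_distrib)
    \<comment> \<open>P M is symmetric and idempotent, so |z|^2 = <x, z> and projecting does not
      increase the norm.\<close>
    have zx: "(norm z)\<^sup>2 \<le> (norm x)\<^sup>2"
    proof -
      have "(norm z)\<^sup>2 = x \<bullet> ((P ** M ** (P ** M)) *v x)"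
        using P unfolding power2_norm_eq_inner z_def inner_matrix_vector
        by (simp only: is_moore_penrose_def matrix_vector_mul_assoc)
      also have "P ** M ** (P ** M) = P ** M"
        using P by (simp add: is_moore_penrose_def matrix_mul_assoc)
      also have "x \<bullet> (P ** M *v x) \<le> norm x * norm z"
        unfolding z_def by (rule norm_cauchy_schwarz)
      finally have "norm z * norm z \<le> norm x * norm z" by (simp add: power2_eq_square)
      then have "norm z \<le> norm x"
        by (cases "norm z = 0") (auto simp: mult_le_cancel_right)
      then show ?thesis by (simp add: power_mono)
    qed
    have "(P ** M - \<alpha> *\<^sub>R (transpose M ** M)) *v x = z - \<alpha> *\<^sub>R (transpose M *v w)"
      by (simp add: Mz z_def matrix_vector_mult_diff_rdistrib matrix_vector_mul_assoc
          scaleR_matrix_vector_assoc)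
    also have "(norm \<dots>)\<^sup>2 = (norm z)\<^sup>2 - 2 * \<alpha> * (norm w)\<^sup>2 + \<alpha>\<^sup>2 * (norm (transpose M *v w))\<^sup>2"
    proof -
      have "z \<bullet> (transpose M *v w) = (norm w)\<^sup>2"
        by (simp add: w_def power2_norm_eq_inner inner_matrix_vector)
      then show ?thesis
        by (simp add: power2_norm_eq_inner inner_diff_left inner_diff_right inner_commute
            power2_eq_square[of \<alpha>])
    qed
    also have "\<dots> \<le> (norm z)\<^sup>2 - 2 * \<alpha> * (norm w)\<^sup>2 + \<alpha>\<^sup>2 * (s\<^sup>2 * (norm w)\<^sup>2)"
      using sw by (intro add_left_mono mult_left_mono) auto
    also have "\<dots> = (norm z)\<^sup>2 - \<alpha> * (2 - \<alpha> * s\<^sup>2) * (norm w)\<^sup>2"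
      by (simp add: algebra_simps power2_eq_square)
    also have "\<dots> \<le> (1 - c) * (norm z)\<^sup>2"
      using zw by (simp add: algebra_simps)
    also have "\<dots> \<le> max 0 (1 - c) * (norm z)\<^sup>2"
      by (intro mult_right_mono) auto
    also have "\<dots> \<le> max 0 (1 - c) * (norm x)\<^sup>2"
      using zx by (intro mult_left_mono) auto
    also have "\<dots> = (r * norm x)\<^sup>2"
      by (simp add: r_def power_mult_distrib)
    finally show ?thesis
      by (rule power2_le_imp_le) (simp add: r_def)
  qed
  then have "spectral_norm (P ** M - \<alpha> *\<^sub>R (transpose M ** M)) \<le> r"
    unfolding spectral_norm_def by (rule onorm_le)
  with \<open>r < 1\<close> show ?thesis by simp
qed

lemma newton_schulz_tendsto:
  fixes M :: "real^'n^'m" and P :: "real^'m^'n" and X :: "nat \<Rightarrow> real^'m^'n"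
  assumes P: "is_moore_penrose M P"
    and \<alpha>: "0 < \<alpha>" "\<alpha> < 2 / (spectral_norm M)\<^sup>2"
    and X0: "X 0 = \<alpha> *\<^sub>R transpose M"
    and XS: "\<And>k. X (Suc k) = X k ** (2 *\<^sub>R mat 1 - M ** X k)"
  shows "X \<longlonglongrightarrow> P"
proof -
  define G where "G k = P ** M - X k ** M" for k
  define r where "r = spectral_norm (G 0)"
  have "r < 1"
    using initial_residual_contraction[OF P \<alpha>]
    by (simp add: r_def G_def X0 flip: scalar_matrix_assoc)
  have "r \<ge> 0" by (simp add: r_def spectral_norm_nonneg)
  have GS: "G (Suc k) = G k ** G k" for k
  proof -
    have "G (Suc k) = - ((X (Suc k) - P) ** M)"
      by (simp add: G_def matrix_diff_rdistrib)
    \<comment> \<open>Rewriting -a as 0 - a lets the distributive law for differences move the sign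
      out of the product.\<close>
    also have "\<dots> = (X k - P) ** M ** (X k - P) ** M"
      unfolding newton_schulz_error[OF P X0 XS]
      by (simp add: matrix_diff_rdistrib flip: diff_0)
    also have "\<dots> = G k ** G k"
      by (simp add: G_def matrix_diff_rdistrib matrix_diff_ldistrib matrix_mul_assoc)
    finally show ?thesis .
  qed
  have G: "spectral_norm (G k) \<le> r ^ (2 ^ k)" for k
  proof (induction k)
    case (Suc k)
    have "spectral_norm (G (Suc k)) \<le> spectral_norm (G k) * spectral_norm (G k)"
      unfolding GS by (rule spectral_norm_mult_le)
    also have "\<dots> \<le> r ^ (2 ^ k) * r ^ (2 ^ k)"
      using Suc \<open>r \<ge> 0\<close> by (intro mult_mono) (auto simp: spectral_norm_nonneg)
    also have "\<dots> = r ^ (2 ^ Suc k)"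
      by (simp add: power_add[symmetric] mult_2)
    finally show ?case .
  qed (simp add: r_def)
  have "norm (X k - P) \<le> r ^ k * norm P" for k
  proof -
    have "P - X k = G k ** P"
      using P by (simp add: G_def matrix_diff_rdistrib is_moore_penrose_def
          newton_schulz_residual[OF P X0 XS])
    then have "norm (X k - P) \<le> spectral_norm (G k) * norm P"
      by (metis norm_minus_commute norm_matrix_mult_spectral_le)
    \<comment> \<open>Since k < 2^k and 0 \<le> r < 1, the doubly exponential bound is weakened to a
      geometric one, which suffices for the limit.\<close>
    also have "spectral_norm (G k) \<le> r ^ k"
      using G[of k] power_decreasing[of k "2 ^ k" r] \<open>r \<ge> 0\<close> \<open>r < 1\<close> less_exp[of k] by simp
    finally show ?thesis by (simp add: mult_right_mono)
  qed
  moreover have "(\<lambda>k. r ^ k * norm P) \<longlonglongrightarrow> 0"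
    using \<open>r \<ge> 0\<close> \<open>r < 1\<close> by (intro tendsto_mult_left_zero LIMSEQ_realpow_zero)
  ultimately have "(\<lambda>k. X k - P) \<longlonglongrightarrow> 0"
    by (intro Lim_null_comparison[of "\<lambda>k. X k - P"]) auto
  then show ?thesis by (simp add: LIM_zero_iff)
qed

section \<open>The real representation\<close>

lemma sum_UNIV_sum:
  "(\<Sum>x\<in>UNIV. f x) = (\<Sum>i\<in>UNIV. f (Inl i)) + (\<Sum>i\<in>UNIV. f (Inr i))"
  for f :: "'a::finite + 'b::finite \<Rightarrow> 'c::comm_monoid_add"
  by (simp add: UNIV_Plus_UNIV[symmetric] sum.Plus del: UNIV_Plus_UNIV)

lemma sq_sum:
  "sq1 (sum f S) = (\<Sum>x\<in>S. sq1 (f x))" "sq2 (sum f S) = (\<Sum>x\<in>S. sq2 (f x))"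
  "sq3 (sum f S) = (\<Sum>x\<in>S. sq3 (f x))" "sq4 (sum f S) = (\<Sum>x\<in>S. sq4 (f x))"
  by (induction S rule: infinite_finite_induct) auto

lemma real_rep_nth:
  "real_rep A $ Inl i $ Inl j = sq1 (A$i$j) + sq3 (A$i$j)"
  "real_rep A $ Inl i $ Inr j = - sq2 (A$i$j) + sq4 (A$i$j)"
  "real_rep A $ Inr i $ Inl j = sq2 (A$i$j) + sq4 (A$i$j)"
  "real_rep A $ Inr i $ Inr j = sq1 (A$i$j) - sq3 (A$i$j)"
  by (simp_all add: real_rep_def block_matrix_def qpart_defs)

lemma vec_sum_eq_iff: "x = y \<longleftrightarrow> (\<forall>i. x $ Inl i = y $ Inl i) \<and> (\<forall>i. x $ Inr i = y $ Inr i)"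
  for x y :: "'c^('a::finite + 'b::finite)"
  unfolding vec_eq_iff by (metis sum.exhaust)

text \<open>On a single entry the block pattern is the isomorphism of the split quaternions with the
  real 2 x 2 matrices; comparing the four blocks extends it to all sizes.\<close>

lemma real_rep_mult: "real_rep (A ** B) = real_rep A ** real_rep B"
  for A :: "split_quat^'n^'m" and B :: "split_quat^'k^'n"
  by (simp add: vec_sum_eq_iff real_rep_nth matrix_matrix_mult_def sum_UNIV_sum sq_sum
      algebra_simps flip: sum.distrib sum_subtractf sum_negf)

lemma real_rep_diff: "real_rep (A - B) = real_rep A - real_rep B"
  by (simp add: vec_sum_eq_iff real_rep_nth)

lemma real_rep_uminus: "real_rep (- A) = - real_rep A"
  by (simp add: vec_sum_eq_iff real_rep_nth)

lemma real_rep_scaleR: "real_rep (c *\<^sub>R A) = c *\<^sub>R real_rep A"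
  by (simp add: vec_sum_eq_iff real_rep_nth algebra_simps)

lemma real_rep_mat_1: "real_rep (mat 1) = mat 1"
  by (simp add: vec_sum_eq_iff real_rep_nth mat_def)

lemma real_rep_qconj_transpose: "real_rep (qconj_transpose A) = transpose (real_rep A)"
  by (simp add: vec_sum_eq_iff real_rep_nth qconj_transpose_def qmat_def transpose_def qpart_defs)

lemma real_rep_qpinv: "real_rep (qpinv A) = real_pinv (real_rep A)"
  unfolding qpinv_def by (simp add: surj_f_inv_f bij_is_surj bij_real_rep)

text \<open>Opposite blocks pair up by (a + b)^2 + (a - b)^2 = 2 (a^2 + b^2), so all mixed terms
  cancel.\<close>

lemma norm_real_rep: "norm (real_rep A) = sqrt 2 * norm A"
proof -
  have "(norm (real_rep A))\<^sup>2 = 2 * (norm A)\<^sup>2"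
    by (simp add: norm_matrix_power2 sum_UNIV_sum real_rep_nth norm_vec_def[of A] norm_vec_def[of "A$_"]
        L2_set_def norm_split_quat_def sum_nonneg power2_sum power2_diff sum_distrib_left
        algebra_simps flip: sum.distrib)
  then have "(norm (real_rep A))\<^sup>2 = (sqrt 2 * norm A)\<^sup>2"
    by (simp add: power_mult_distrib)
  then show ?thesis by simp
qed

text \<open>Passing to real representations contributes sqrt 2 once on the left but once for each of
  the two factors E on the right; the surplus is the constant in the bound.\<close>

lemma norm_mult_split_quat_le:
  "norm (E ** A ** E) \<le> sqrt 2 * sigma2_norm A * (norm E)\<^sup>2"
  for A :: "split_quat^'n^'m" and E :: "split_quat^'m^'n"
proof -
  have "sqrt 2 * norm (E ** A ** E) = norm (real_rep E ** (real_rep A ** real_rep E))"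
    by (simp add: norm_real_rep[symmetric] real_rep_mult matrix_mul_assoc)
  also have "\<dots> \<le> norm (real_rep E) * (sigma2_norm A * norm (real_rep E))"
    unfolding sigma2_norm_def
    by (rule order_trans[OF norm_matrix_mult_le])
      (intro mult_left_mono norm_matrix_mult_spectral_le norm_ge_zero)
  also have "\<dots> = sqrt 2 * (sqrt 2 * sigma2_norm A * (norm E)\<^sup>2)"
    by (simp add: norm_real_rep power2_eq_square)
  finally show ?thesis by simp
qed

theorem theorem4p7:
  fixes A :: "split_quat^'n^'m"
    and M :: "real^('n + 'n)^('m + 'm)"
    and \<alpha> :: real
    and Xhat Ehat :: "nat \<Rightarrow> split_quat^'m^'n"
    and X :: "nat \<Rightarrow> real^('m + 'm)^('n + 'n)"
  assumes "A \<noteq> 0"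
    and "M = real_rep A"
    and "0 < \<alpha>" and "\<alpha> < 2 / (spectral_norm M)\<^sup>2"
    and "Xhat 0 = \<alpha> *\<^sub>R qconj_transpose A"
    and "\<And>k. Xhat (Suc k) = Xhat k ** (2 *\<^sub>R mat 1 - A ** Xhat k)"
    and "\<And>k. X k = real_rep (Xhat k)"
    and "\<And>k. Ehat k = Xhat k - qpinv A"
  shows "X 0 = \<alpha> *\<^sub>R transpose M
    \<and> (\<forall>k. X (Suc k) = X k ** (2 *\<^sub>R mat 1 - M ** X k))
    \<and> Xhat \<longlonglongrightarrow> qpinv A
    \<and> (\<forall>k. Ehat (Suc k) = - (Ehat k ** A ** Ehat k))
    \<and> (\<forall>k. qfrobenius_norm (Ehat (Suc k))
            \<le> sqrt 2 * sigma2_norm A * (qfrobenius_norm (Ehat k))\<^sup>2)"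
proof -
  note M = assms(2) and Xhat = assms(5,6) and X = assms(7) and Ehat = assms(8)
  have X0: "X 0 = \<alpha> *\<^sub>R transpose M"
    by (simp add: X Xhat M real_rep_scaleR real_rep_qconj_transpose)
  have XS: "X (Suc k) = X k ** (2 *\<^sub>R mat 1 - M ** X k)" for k
    by (simp add: X Xhat M real_rep_mult real_rep_diff real_rep_scaleR real_rep_mat_1)
  note P = is_moore_penrose_real_pinv[of M]
  have EX: "real_rep (Ehat k) = X k - real_pinv M" for k
    by (simp add: Ehat X M real_rep_diff real_rep_qpinv)
  \<comment> \<open>The real error identity is an equation between images under
    \<open>real_rep\<close>, and injectivity pulls it back.\<close>
  have "real_rep (Ehat (Suc k)) = real_rep (- (Ehat k ** A ** Ehat k))" for k
    using newton_schulz_error[OF P X0 XS, of k]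
    by (simp add: real_rep_uminus real_rep_mult EX flip: M)
  then have ES: "Ehat (Suc k) = - (Ehat k ** A ** Ehat k)" for k
    by (metis bij_real_rep bij_is_inj injD)
  have "(\<lambda>k. norm (X k - real_pinv M)) \<longlonglongrightarrow> 0"
    using newton_schulz_tendsto[OF P assms(3,4) X0 XS] by (simp add: LIM_zero tendsto_norm_zero)
  \<comment> \<open>Dividing by sqrt 2 gives exactly the norm of \<open>Ehat k\<close>, so
    convergence descends to the split quaternions.\<close>
  then have "(\<lambda>k. norm (real_rep (Ehat k)) / sqrt 2) \<longlonglongrightarrow> 0"
    unfolding EX by (rule tendsto_divide_zero)
  then have "(\<lambda>k. norm (Xhat k - qpinv A)) \<longlonglongrightarrow> 0"
    by (simp add: norm_real_rep Ehat)
  then have "Xhat \<longlonglongrightarrow> qpinv A"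
    by (simp add: tendsto_norm_zero_iff LIM_zero_iff)
  with X0 XS ES show ?thesis
    using norm_mult_split_quat_le[of _ A] by (simp flip: norm_eq_qfrobenius_norm)
qed

end
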